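(* Consider the GCR-MDP $\min_{\pi\in\Pi}\varrho_{\mathcal U}(R^\pi_{0:T})$, where the risk frontier $\mathcal U$ has the recursive structure described in the context. The value functions $\{V_t\}_{t=0}^{T+1}$ satisfy the decomposition $$V_t(h_t)=\min_{(X_t,z_t,\varphi_t)}\{\varphi_t:(X_t,z_t,\varphi_t)\in\mathcal Q_t(h_t,V_{t+1})\},\quad\forall h_t\in\mathbb H_t,\ \forall t\in[T].$$ Furthermore, $V_0(s_0)=\min_{\pi\in\Pi}\varrho_{\mathcal U}(R^\pi_{0:T})$.
   Context: Notation: $[n]=\{0,\dots,n\}$, $[n_1,n_2]=\{n_1,\dots,n_2\}$. Fix a horizon $0\le T<\infty$. MDP: the state space $\mathbb S$, action space $\mathbb A$ and data space $\Xi$ are finite, $s_0\in\mathbb S$ is fixed, $s_{t+1}=f_t(s_t,a_t,\xi_t)$ with $f_t:\mathbb S\times\mathbb A\times\Xi\to\mathbb S$ for $t\in[T-1]$, where $\xi_t\in\Xi$ is random. Payoffs are $r_t:\mathbb S\times\mathbb A\times\Xi\to\mathbb R$, $|r_t|\le R_{\max}<\infty$, $t\in[T]$; $R_t(s,a)$ is the random payoff with realizations $[R_t(s,a)](\xi_t)=r_t(s,a,\xi_t)$. Histories are $h_t=(s_0,a_0,\xi_0,\dots,a_{t-1},\xi_{t-1})$, $t\in[T+1]$; $\mathbb H_t$ is the set of them. $\mathcal L_t$ is the space of bounded random variables determined by $h_t$ (functions on $\mathbb H_t$); $\mathcal L_{t:T}=\prod_{k=t}^T\mathcal L_k$, $\mathcal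 L_{t+1:T+1}=\prod_{k=t+1}^{T+1}\mathcal L_k$. Payoff streams $X_{t:T}\in\mathcal L_{t+1:T+1}$ have $X_k\in\mathcal L_{k+1}$; disbursements and premiums $Z_{t:T},\Phi_{t:T}\in\mathcal L_{t:T}$ have $Z_k,\Phi_k\in\mathcal L_k$; $\varphi_0$ is the constant $\Phi_0$. Inequalities are componentwise and almost sure. The decision maker has perfect recall of past payoffs, disbursements and premiums given $h_t$. Policies: $\Pi$ is the set of $\pi=(\pi_t)_{t\in[T]}$ with $\pi_t=(\pi_t^a,\pi_t^z):\mathbb H_t\to\mathbb A\times\mathbb R$; $\pi_{t:T}=(\pi_t,\dots,\pi_T)$. $R_t^\pi(h_t,\xi_t)=r_t(s_t,\pi_t^a(h_t),\xi_t)$ and $Z_t^\pi(h_t)=\pi_t^z(h_t)$; similarly for tail policies. Conditioning convention: $[\,\cdot\mid h_t]$ denotes conditioning on $h_t$. Conditionally on $h_t$ and the period-$t$ action $a$ (under a policy, $a=\pi_t^a(h_t)$; in $\mathcal D_t,\mathcal Q_t$ below, the action $a$ appearing in $\mathcal D_t$), $X_t,\Phi_{t+1}\in\mathcal L_{t+1}$ are regarded as the random variables $\xi_t\mapsto X_t(h_t,a,\xi_t)$, $\xi_t\mapsto\Phi_{t+1}(h_t,a,\xi_t)$, and membership in $\mathcal U_t(h_t,\Phi_{t+1})$ is understood for these. Risk frontier: a set $\mathcal U\subset\mathcal L_{1:T+1}\times\mathcal L_{0:T}\times\mathcal L_{0:T}$ is a risk frontier if: (i) membership of $(X_{0:T},Z_{0:T},\Phi_{0:T})$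 implies membership of $(X'_{0:T},Z_{0:T},\Phi_{0:T})$ for all $X'_{0:T}\ge X_{0:T}$; (ii) membership of $(X_{0:T},Z_{0:T},\Phi_{0:T})$ implies membership of $(X_{0:T},Z_{0:T},\Phi_{0:T}+\Phi'_{0:T})$ for all $\Phi'_{0:T}\ge0$ with $\Phi'_t(h_t)\ge\mathbb E[\Phi'_{t+1}\mid h_t]$ for all $h_t$, $t\in[T-1]$; (iii) membership of $(X_{0:T},Z_{0:T},\Phi_{0:T})$ and $Z'_{0:T}\ge Z_{0:T}$ imply membership of $(X_{0:T},Z'_{0:T},\Phi'_{0:T})$ for some $\Phi'_{0:T}\ge\Phi_{0:T}$; (iv) $\mathcal U$ is closed. Recursive structure: a terminal input $\Phi_{T+1}\in\mathcal L_{T+1}$ is fixed and there are correspondences $\mathcal U_t:\mathbb H_t\times\mathcal L_{t+1}\rightrightarrows\mathcal L_{t+1}\times\mathbb R\times\mathbb R$, $t\in[T]$, such that (a) $\mathcal U=\{(X_{0:T},Z_{0:T},\Phi_{0:T}):[(X_t,Z_t,\Phi_t)\mid h_t]\in\mathcal U_t(h_t,\Phi_{t+1}),\ \forall h_t\in\mathbb H_t,\ \forall t\in[T]\}$; (b) $(X_t,z_t,\varphi_t)\in\mathcal U_t(h_t,\Phi_{t+1})$ and $X_t\le X'_t$ imply $(X'_t,z_t,\varphi_t)\in\mathcal U_t(h_t,\Phi_{t+1})$; (c) $\Phi_{t+1}\le\Phi'_{t+1}$ implies $\mathcal U_t(h_t,\Phi'_{t+1})\subset\mathcal U_t(h_t,\Phi_{t+1})$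 for all $h_t$. GCR-MDP: $\min_{\pi\in\Pi}\varrho_{\mathcal U}(R_{0:T}^\pi)\equiv\min_{\pi\in\Pi,\Phi_{0:T}}\{\varphi_0:(R_{0:T}^\pi,Z_{0:T}^\pi,\Phi_{0:T})\in\mathcal U\}$. Value functions: $V_{T+1}=\Phi_{T+1}$ is the given terminal input. For $t\in[T]$ and $h_t\in\mathbb H_t$, $$V_t^{\pi_{t:T}}(h_t)=\min_{\Phi_{t:T}}\{\Phi_t(h_t):[(R_k^{\pi},Z_k^{\pi},\Phi_k)\mid h_k]\in\mathcal U_k(h_k,\Phi_{k+1}),\ \forall h_k\in\mathbb H_k,\ \forall k\in[t,T]\}$$ (the constraints say that the tail triple given $h_t$ lies in the tail risk frontier $\mathcal U_{t:T}(h_t)$; infeasible problems have value $+\infty$), and $V_t(h_t)=\min_{\pi_{t:T}}V_t^{\pi_{t:T}}(h_t)$. The minima defining $V_t$ are understood to exist, so $V_t$ is a bounded real function on $\mathbb H_t$. Dominance constraints: $\mathcal D_t(h_t,V_{t+1})$ is the set of $(X_t,z_t,\Phi_{t+1})\in\mathcal L_{t+1}\times\mathbb R\times\mathcal L_{t+1}$ for which there is $a\in\mathbb A$ with $X_t(h_t,a,\xi_t)\le r_t(s_t,a,\xi_t)$ and $V_{t+1}(h_t,a,\xi_t)\le\Phi_{t+1}(h_t,a,\xi_t)$ for all $\xi_t\in\Xi$. $\mathcal Q_t(h_t,V_{t+1})$ is the set of $(X_t,z_t,\varphi_t)\in\mathcal L_{t+1}\times\mathbb R\times\mathbb R$ such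 that, for some $\Phi_{t+1}\in\mathcal L_{t+1}$, $(X_t,z_t,\varphi_t)\in\mathcal U_t(h_t,\Phi_{t+1})$ and $(X_t,z_t,\Phi_{t+1})\in\mathcal D_t(h_t,V_{t+1})$. *)

theory Defs
  imports "HOL-Probability.Probability"
begin

(* The history (s_0, a_0, xi_0, ..., a_{t-1}, xi_{t-1}) is represented by the chronological
   list [(a_0, xi_0), ..., (a_{t-1}, xi_{t-1})]; the initial state s_0 is fixed and hence omitted. *)
type_synonym ('a, 'x) hist = "('a \<times> 'x) list"

definition hists :: "nat \<Rightarrow> ('a, 'x) hist set" where
  "hists t = {h. length h = t}"

(* Random variables determined by h_t are functions of histories of which only the values on
   hists t matter (they are bounded, as hists t is finite).  In payoff streams X the component
   X k is a function on hists (k + 1); in disbursements Z and premiums \<Phi> the k-th component is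
   a function on hists k.  Components beyond the horizon are irrelevant. *)
type_synonym ('a, 'x) rv = "('a, 'x) hist \<Rightarrow> real"
type_synonym ('a, 'x) stream = "nat \<Rightarrow> ('a, 'x) rv"

type_synonym ('a, 'x) act_rule = "nat \<Rightarrow> ('a, 'x) hist \<Rightarrow> 'a"
type_synonym ('a, 'x) policy = "nat \<Rightarrow> ('a, 'x) hist \<Rightarrow> 'a \<times> real"

(* One-period correspondences.  Given h_t and the period-t action, elements of L_{t+1} are
   regarded as random variables of xi_t alone, so the correspondences act on functions of xi_t. *)
type_synonym ('a, 'x) corr =
  "nat \<Rightarrow> ('a, 'x) hist \<Rightarrow> ('x \<Rightarrow> real) \<Rightarrow> (('x \<Rightarrow> real) \<times> real \<times> real) set"

definition given :: "('a, 'x) rv \<Rightarrow> ('a, 'x) hist \<Rightarrow> 'a \<Rightarrow> 'x \<Rightarrow> real" where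
  "given Y h a = (\<lambda>x. Y (h @ [(a, x)]))"

fun state_from :: "(nat \<Rightarrow> 's \<Rightarrow> 'a \<Rightarrow> 'x \<Rightarrow> 's) \<Rightarrow> nat \<Rightarrow> 's \<Rightarrow> ('a, 'x) hist \<Rightarrow> 's" where
  "state_from f t s [] = s"
| "state_from f t s ((a, x) # h) = state_from f (Suc t) (f t s a x) h"

abbreviation state :: "(nat \<Rightarrow> 's \<Rightarrow> 'a \<Rightarrow> 'x \<Rightarrow> 's) \<Rightarrow> 's \<Rightarrow> ('a, 'x) hist \<Rightarrow> 's" where
  "state f s0 h \<equiv> state_from f 0 s0 h"

definition act :: "('a, 'x) policy \<Rightarrow> ('a, 'x) act_rule" where
  "act \<pi> k h = fst (\<pi> k h)"

definition disb :: "('a, 'x) policy \<Rightarrow> ('a, 'x) stream" where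
  "disb \<pi> k h = snd (\<pi> k h)"

(* R_k^\<pi>(h_k, xi_k) as a function of h_{k+1}; the action recorded at the end of h_{k+1}
   plays no role, the one prescribed by the policy at h_k is used. *)
definition payoff ::
  "(nat \<Rightarrow> 's \<Rightarrow> 'a \<Rightarrow> 'x \<Rightarrow> 's) \<Rightarrow> (nat \<Rightarrow> 's \<Rightarrow> 'a \<Rightarrow> 'x \<Rightarrow> real) \<Rightarrow> 's
    \<Rightarrow> ('a, 'x) policy \<Rightarrow> ('a, 'x) stream" where
  "payoff f r s0 \<pi> k h' =
    r k (state f s0 (butlast h')) (act \<pi> k (butlast h')) (snd (last h'))"

(* P h is the conditional law of xi_t given the history h of length t.
   Almost sure inequality in L_t: deterministic for t = 0; otherwise xi_{t-1}-almost surely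
   given each h_{t-1} and each action. *)
definition as_le :: "(('a, 'x) hist \<Rightarrow> 'x pmf) \<Rightarrow> nat \<Rightarrow> ('a, 'x) rv \<Rightarrow> ('a, 'x) rv \<Rightarrow> bool" where
  "as_le P t Y Y' \<longleftrightarrow>
    (case t of
       0 \<Rightarrow> Y [] \<le> Y' []
     | Suc k \<Rightarrow> \<forall>h\<in>hists k. \<forall>a. AE x in measure_pmf (P h). given Y h a x \<le> given Y' h a x)"

(* Conditional expectations and conditional membership refer to the actions that
   are taken, so a risk frontier is considered relative to an action rule \<alpha>.
   Closedness is with respect to pointwise convergence; on the finitely many histories up to the
   horizon this is the usual topology. *)
definition risk_frontier ::
  "(('a, 'x) hist \<Rightarrow> 'x pmf) \<Rightarrow> nat \<Rightarrow> ('a, 'x) act_rule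
    \<Rightarrow> (('a, 'x) stream \<times> ('a, 'x) stream \<times> ('a, 'x) stream) set \<Rightarrow> bool" where
  "risk_frontier P T \<alpha> U \<longleftrightarrow>
    (\<forall>X Z \<Phi> X'. (X, Z, \<Phi>) \<in> U \<and> (\<forall>t\<le>T. as_le P (Suc t) (X t) (X' t)) \<longrightarrow> (X', Z, \<Phi>) \<in> U) \<and>
    (\<forall>X Z \<Phi> \<Phi>'. (X, Z, \<Phi>) \<in> U \<and> (\<forall>t\<le>T. as_le P t (\<lambda>_. 0) (\<Phi>' t)) \<and>
        (\<forall>t<T. \<forall>h\<in>hists t.
           \<Phi>' t h \<ge> measure_pmf.expectation (P h) (given (\<Phi>' (Suc t)) h (\<alpha> t h)))
      \<longrightarrow> (X, Z, \<lambda>t h. \<Phi> t h + \<Phi>' t h) \<in> U) \<and>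
    (\<forall>X Z \<Phi> Z'. (X, Z, \<Phi>) \<in> U \<and> (\<forall>t\<le>T. as_le P t (Z t) (Z' t))
      \<longrightarrow> (\<exists>\<Phi>'. (\<forall>t\<le>T. as_le P t (\<Phi> t) (\<Phi>' t)) \<and> (X, Z', \<Phi>') \<in> U)) \<and>
    closed U"

(* The premium following the last period is the terminal input \<Phi>T. *)
definition tail_frontier ::
  "nat \<Rightarrow> ('a, 'x) corr \<Rightarrow> ('a, 'x) rv \<Rightarrow> ('a, 'x) act_rule \<Rightarrow> nat
    \<Rightarrow> (('a, 'x) stream \<times> ('a, 'x) stream \<times> ('a, 'x) stream) set" where
  "tail_frontier T \<U> \<Phi>T \<alpha> t =
    {(X, Z, \<Phi>). \<forall>k\<in>{t..T}. \<forall>h\<in>hists k.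
       (given (X k) h (\<alpha> k h), Z k h, \<Phi> k h)
         \<in> \<U> k h (given ((\<Phi>(Suc T := \<Phi>T)) (Suc k)) h (\<alpha> k h))}"

definition recursive_structure ::
  "(('a, 'x) hist \<Rightarrow> 'x pmf) \<Rightarrow> nat \<Rightarrow> ('a, 'x) corr \<Rightarrow> ('a, 'x) rv
    \<Rightarrow> (('a, 'x) act_rule \<Rightarrow> (('a, 'x) stream \<times> ('a, 'x) stream \<times> ('a, 'x) stream) set)
    \<Rightarrow> bool" where
  "recursive_structure P T \<U> \<Phi>T U \<longleftrightarrow>
    (\<forall>\<alpha>. U \<alpha> = tail_frontier T \<U> \<Phi>T \<alpha> 0) \<and>
    (\<forall>t\<le>T. \<forall>h\<in>hists t. \<forall>\<Psi> X X' z \<phi>.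
      (X, z, \<phi>) \<in> \<U> t h \<Psi> \<and> (AE x in measure_pmf (P h). X x \<le> X' x)
        \<longrightarrow> (X', z, \<phi>) \<in> \<U> t h \<Psi>) \<and>
    (\<forall>t\<le>T. \<forall>h\<in>hists t. \<forall>\<Psi> \<Psi>'.
      (AE x in measure_pmf (P h). \<Psi> x \<le> \<Psi>' x) \<longrightarrow> \<U> t h \<Psi>' \<subseteq> \<U> t h \<Psi>)"

definition is_min :: "'v::order set \<Rightarrow> 'v \<Rightarrow> bool" where
  "is_min S v \<longleftrightarrow> v \<in> S \<and> (\<forall>w\<in>S. v \<le> w)"

(* The minimum of this set is the minimum over \<pi> of the risk of the payoffs under \<pi>, which is
   by definition the joint minimum of \<phi>_0 over \<pi> and \<Phi>. *)
definition gcr_mdp_values ::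
  "(nat \<Rightarrow> 's \<Rightarrow> 'a \<Rightarrow> 'x \<Rightarrow> 's) \<Rightarrow> (nat \<Rightarrow> 's \<Rightarrow> 'a \<Rightarrow> 'x \<Rightarrow> real) \<Rightarrow> 's
    \<Rightarrow> (('a, 'x) act_rule \<Rightarrow> (('a, 'x) stream \<times> ('a, 'x) stream \<times> ('a, 'x) stream) set)
    \<Rightarrow> ereal set" where
  "gcr_mdp_values f r s0 U =
    {ereal (\<Phi> 0 []) | \<pi> \<Phi>. (payoff f r s0 \<pi>, disb \<pi>, \<Phi>) \<in> U (act \<pi>)}"

definition feasible_premiums ::
  "nat \<Rightarrow> (nat \<Rightarrow> 's \<Rightarrow> 'a \<Rightarrow> 'x \<Rightarrow> 's) \<Rightarrow> (nat \<Rightarrow> 's \<Rightarrow> 'a \<Rightarrow> 'x \<Rightarrow> real) \<Rightarrow> 's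
    \<Rightarrow> ('a, 'x) corr \<Rightarrow> ('a, 'x) rv \<Rightarrow> ('a, 'x) policy \<Rightarrow> nat \<Rightarrow> ('a, 'x) stream set" where
  "feasible_premiums T f r s0 \<U> \<Phi>T \<pi> t =
    {\<Phi>. (payoff f r s0 \<pi>, disb \<pi>, \<Phi>) \<in> tail_frontier T \<U> \<Phi>T (act \<pi>) t}"

(* The infimum is \<infinity> for infeasible problems.  Only the components of \<pi> from t on matter. *)
definition policy_value ::
  "nat \<Rightarrow> (nat \<Rightarrow> 's \<Rightarrow> 'a \<Rightarrow> 'x \<Rightarrow> 's) \<Rightarrow> (nat \<Rightarrow> 's \<Rightarrow> 'a \<Rightarrow> 'x \<Rightarrow> real) \<Rightarrow> 's
    \<Rightarrow> ('a, 'x) corr \<Rightarrow> ('a, 'x) rv \<Rightarrow> ('a, 'x) policy \<Rightarrow> nat \<Rightarrow> ('a, 'x) hist \<Rightarrow> ereal" where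
  "policy_value T f r s0 \<U> \<Phi>T \<pi> t h =
    (INF \<Phi>\<in>feasible_premiums T f r s0 \<U> \<Phi>T \<pi> t. ereal (\<Phi> t h))"

definition opt_value ::
  "nat \<Rightarrow> (nat \<Rightarrow> 's \<Rightarrow> 'a \<Rightarrow> 'x \<Rightarrow> 's) \<Rightarrow> (nat \<Rightarrow> 's \<Rightarrow> 'a \<Rightarrow> 'x \<Rightarrow> real) \<Rightarrow> 's
    \<Rightarrow> ('a, 'x) corr \<Rightarrow> ('a, 'x) rv \<Rightarrow> nat \<Rightarrow> ('a, 'x) hist \<Rightarrow> ereal" where
  "opt_value T f r s0 \<U> \<Phi>T t h =
    (if t = Suc T then ereal (\<Phi>T h) else (INF \<pi>. policy_value T f r s0 \<U> \<Phi>T \<pi> t h))"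

(* The optimal values are minima: some policy is optimal, and the minimum over premiums defining
   its value is attained.  In particular the optimal values are finite. *)
definition minima_exist ::
  "nat \<Rightarrow> (nat \<Rightarrow> 's \<Rightarrow> 'a \<Rightarrow> 'x \<Rightarrow> 's) \<Rightarrow> (nat \<Rightarrow> 's \<Rightarrow> 'a \<Rightarrow> 'x \<Rightarrow> real) \<Rightarrow> 's
    \<Rightarrow> ('a, 'x) corr \<Rightarrow> ('a, 'x) rv \<Rightarrow> bool" where
  "minima_exist T f r s0 \<U> \<Phi>T \<longleftrightarrow>
    (\<forall>t\<le>T. \<forall>h\<in>hists t. \<exists>\<pi>.
       opt_value T f r s0 \<U> \<Phi>T t h = policy_value T f r s0 \<U> \<Phi>T \<pi> t h \<and>
       (\<exists>\<Phi>\<in>feasible_premiums T f r s0 \<U> \<Phi>T \<pi> t.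
          policy_value T f r s0 \<U> \<Phi>T \<pi> t h = ereal (\<Phi> t h)))"

(* The dominance constraint witnessed by the action a; the set D_t is the union of these over a. *)
definition dominance ::
  "(nat \<Rightarrow> 's \<Rightarrow> 'a \<Rightarrow> 'x \<Rightarrow> 's) \<Rightarrow> (nat \<Rightarrow> 's \<Rightarrow> 'a \<Rightarrow> 'x \<Rightarrow> real) \<Rightarrow> 's
    \<Rightarrow> nat \<Rightarrow> ('a, 'x) hist \<Rightarrow> (('a, 'x) hist \<Rightarrow> ereal) \<Rightarrow> 'a
    \<Rightarrow> (('a, 'x) rv \<times> real \<times> ('a, 'x) rv) set" where
  "dominance f r s0 t h W a =
    {(X, z, \<Phi>). \<forall>x. X (h @ [(a, x)]) \<le> r t (state f s0 h) a x \<and>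
                  W (h @ [(a, x)]) \<le> ereal (\<Phi> (h @ [(a, x)]))}"

(* Conditional membership in the correspondence is with respect to the same action a. *)
definition Q_set ::
  "(nat \<Rightarrow> 's \<Rightarrow> 'a \<Rightarrow> 'x \<Rightarrow> 's) \<Rightarrow> (nat \<Rightarrow> 's \<Rightarrow> 'a \<Rightarrow> 'x \<Rightarrow> real) \<Rightarrow> 's
    \<Rightarrow> ('a, 'x) corr \<Rightarrow> nat \<Rightarrow> ('a, 'x) hist \<Rightarrow> (('a, 'x) hist \<Rightarrow> ereal)
    \<Rightarrow> (('a, 'x) rv \<times> real \<times> real) set" where
  "Q_set f r s0 \<U> t h W =
    {(X, z, \<phi>). \<exists>\<Phi> a. (given X h a, z, \<phi>) \<in> \<U> t h (given \<Phi> h a) \<and>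
                     (X, z, \<Phi>) \<in> dominance f r s0 t h W a}"

end

theory Submission imports Defs begin

text \<open>The constraints defining a tail problem are local: the one at a history \<open>h\<close> involves the policy
  and the premium at \<open>h\<close> and the premium one step later.  Hence optimal pairs of a policy and a
  premium process, one for each history of length \<open>t\<close>, can be pasted into a single pair that is
  optimal at all histories of length \<open>t\<close> simultaneously.  Given a point of \<open>Q_set\<close> at \<open>h\<close>,
  monotonicity of the correspondence in the payoff and antitonicity in the continuation premium
  allow us to replace the payoff by that of the action and the continuation premium by the value
  function; a policy that continues optimally from time \<open>t + 1\<close> then attains this point.\<close>

text \<open>The condition of \<open>tail_frontier\<close> at a single history, specialised to the
  payoffs and disbursements of a policy. The case distinction on \<open>k = T\<close> replaces the
  update of the premium stream at \<open>Suc T\<close>.\<close>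

definition local_constraint ::
  "nat \<Rightarrow> (nat \<Rightarrow> 's \<Rightarrow> 'a \<Rightarrow> 'x \<Rightarrow> 's) \<Rightarrow> (nat \<Rightarrow> 's \<Rightarrow> 'a \<Rightarrow> 'x \<Rightarrow> real) \<Rightarrow> 's
    \<Rightarrow> ('a, 'x) corr \<Rightarrow> ('a, 'x) rv \<Rightarrow> ('a, 'x) policy \<Rightarrow> ('a, 'x) stream
    \<Rightarrow> nat \<Rightarrow> ('a, 'x) hist \<Rightarrow> bool" where
  "local_constraint T f r s0 \<U> \<Phi>T \<pi> \<Phi> k h \<longleftrightarrow>
    (r k (state f s0 h) (fst (\<pi> k h)), snd (\<pi> k h), \<Phi> k h)
      \<in> \<U> k h (given (if k = T then \<Phi>T else \<Phi> (Suc k)) h (fst (\<pi> k h)))"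

lemma given_payoff:
  "given (payoff f r s0 \<pi> k) h a = r k (state f s0 h) (fst (\<pi> k h))"
  by (simp add: given_def payoff_def act_def)

lemma feasible_premiums_iff:
  "\<Phi> \<in> feasible_premiums T f r s0 \<U> \<Phi>T \<pi> t \<longleftrightarrow>
    (\<forall>k\<in>{t..T}. \<forall>h\<in>hists k. local_constraint T f r s0 \<U> \<Phi>T \<pi> \<Phi> k h)"
  by (auto simp: feasible_premiums_def tail_frontier_def local_constraint_def given_payoff
      act_def disb_def)

text \<open>This is the locality that pasting relies on. The guard \<open>k \<noteq> T\<close> is
  there because the terminal input takes the place of the next premium at the horizon.\<close>

lemma local_constraint_cong:
  assumes "\<pi> k h = \<pi>' k h" "\<Phi> k h = \<Phi>' k h"
    and "\<And>a x. k \<noteq> T \<Longrightarrow> \<Phi> (Suc k) (h @ [(a, x)]) = \<Phi>' (Suc k) (h @ [(a, x)])"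
  shows "local_constraint T f r s0 \<U> \<Phi>T \<pi> \<Phi> k h \<longleftrightarrow> local_constraint T f r s0 \<U> \<Phi>T \<pi>' \<Phi>' k h"
proof -
  have "given (if k = T then \<Phi>T else \<Phi> (Suc k)) h a
      = given (if k = T then \<Phi>T else \<Phi>' (Suc k)) h a" for a
    using assms(3) by (auto simp: given_def)
  then show ?thesis
    using assms(1,2) by (simp add: local_constraint_def)
qed

lemma opt_value_le:
  assumes "t \<le> T" "\<Phi> \<in> feasible_premiums T f r s0 \<U> \<Phi>T \<pi> t"
  shows "opt_value T f r s0 \<U> \<Phi>T t h \<le> ereal (\<Phi> t h)"
proof -
  have "opt_value T f r s0 \<U> \<Phi>T t h \<le> policy_value T f r s0 \<U> \<Phi>T \<pi> t h"
    using assms(1) by (auto simp: opt_value_def intro: INF_lower)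
  also have "\<dots> \<le> ereal (\<Phi> t h)"
    unfolding policy_value_def using assms(2) by (rule INF_lower)
  finally show ?thesis .
qed

lemma opt_value_attained:
  assumes "minima_exist T f r s0 \<U> \<Phi>T" "t \<le> T" "h \<in> hists t"
  obtains \<pi> \<Phi> where "\<Phi> \<in> feasible_premiums T f r s0 \<U> \<Phi>T \<pi> t"
    "opt_value T f r s0 \<U> \<Phi>T t h = ereal (\<Phi> t h)"
  using assms unfolding minima_exist_def by metis

text \<open>\<open>minima_exist\<close> yields a separate optimum for each history, whereas the
  backward step needs one continuation that is optimal after every outcome \<open>x\<close> at once.
  Distinct histories of length \<open>t\<close> have no common extensions, so their optima can be
  combined without conflict.\<close>

lemma simultaneous_optimum:
  fixes \<U> :: "('a, 'x) corr"
  assumes minima: "minima_exist T f r s0 \<U> \<Phi>T" and "t \<le> Suc T"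
  obtains \<pi> \<Phi> where "\<Phi> \<in> feasible_premiums T f r s0 \<U> \<Phi>T \<pi> t"
    "\<And>h. h \<in> hists t \<Longrightarrow> opt_value T f r s0 \<U> \<Phi>T t h = ereal (\<Phi> t h)"
proof (cases "t = Suc T")
  case True
  \<comment> \<open>The range \<open>{Suc T..T}\<close> is empty, so any policy is feasible; the
    premium must agree with the terminal value \<open>\<Phi>T\<close>.\<close>
  show ?thesis
    by (rule that[of "\<lambda>_. \<Phi>T" undefined])
      (auto simp: True feasible_premiums_iff opt_value_def)
next
  case False
  with \<open>t \<le> Suc T\<close> have "t \<le> T" by simp
  have "\<forall>g\<in>hists t. \<exists>\<pi> \<Phi>. \<Phi> \<in> feasible_premiums T f r s0 \<U> \<Phi>T \<pi> t \<and>
      opt_value T f r s0 \<U> \<Phi>T t g = ereal (\<Phi> t g)"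
    using opt_value_attained[OF minima \<open>t \<le> T\<close>] by metis
  then obtain p F where F: "\<And>g. g \<in> hists t \<Longrightarrow> F g \<in> feasible_premiums T f r s0 \<U> \<Phi>T (p g) t"
    and opt: "\<And>g. g \<in> hists t \<Longrightarrow> opt_value T f r s0 \<U> \<Phi>T t g = ereal (F g t g)"
    by metis
  \<comment> \<open>The prefix of length \<open>t\<close> selects the pair. As \<open>k\<close> is
    at least \<open>t\<close>, a history and its one-step extensions share this prefix, so each
    constraint sees only one of the chosen pairs.\<close>
  define \<pi> where "\<pi> = (\<lambda>k h. p (take t h) k h)"
  define \<Phi> where "\<Phi> = (\<lambda>k h. F (take t h) k h)"
  show ?thesis
  proof (rule that)
    show "\<Phi> \<in> feasible_premiums T f r s0 \<U> \<Phi>T \<pi> t"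
      unfolding feasible_premiums_iff
    proof (intro ballI)
      fix k and h :: "('a, 'x) hist"
      assume k: "k \<in> {t..T}" and h: "h \<in> hists k"
      from k h have "take t h \<in> hists t"
        by (auto simp: hists_def)
      from F[OF this] k h
      have "local_constraint T f r s0 \<U> \<Phi>T (p (take t h)) (F (take t h)) k h"
        by (simp add: feasible_premiums_iff)
      moreover have "local_constraint T f r s0 \<U> \<Phi>T \<pi> \<Phi> k h \<longleftrightarrow>
          local_constraint T f r s0 \<U> \<Phi>T (p (take t h)) (F (take t h)) k h"
        by (rule local_constraint_cong) (use k h in \<open>auto simp: \<pi>_def \<Phi>_def hists_def\<close>)
      ultimately show "local_constraint T f r s0 \<U> \<Phi>T \<pi> \<Phi> k h" by simp
    qed
    show "opt_value T f r s0 \<U> \<Phi>T t h = ereal (\<Phi> t h)" if "h \<in> hists t" for h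
      using opt[OF that] that by (simp add: \<Phi>_def hists_def)
  qed
qed

text \<open>An optimal pair at \<open>h\<close> supplies the point. Its premiums remain feasible
  from \<open>Suc t\<close> on and therefore dominate the value function there, which is the
  dominance constraint.\<close>

lemma opt_value_in_Q_set:
  assumes minima: "minima_exist T f r s0 \<U> \<Phi>T" and t: "t \<le> T" and h: "h \<in> hists t"
  shows "\<exists>X z \<phi>. opt_value T f r s0 \<U> \<Phi>T t h = ereal \<phi> \<and>
    (X, z, \<phi>) \<in> Q_set f r s0 \<U> t h (opt_value T f r s0 \<U> \<Phi>T (Suc t))"
proof -
  obtain \<pi> \<Phi> where feas: "\<Phi> \<in> feasible_premiums T f r s0 \<U> \<Phi>T \<pi> t"
    and opt: "opt_value T f r s0 \<U> \<Phi>T t h = ereal (\<Phi> t h)"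
    by (rule opt_value_attained[OF minima t h])
  let ?\<Psi> = "if t = T then \<Phi>T else \<Phi> (Suc t)"
  have "opt_value T f r s0 \<U> \<Phi>T (Suc t) g \<le> ereal (?\<Psi> g)" for g
  proof (cases "t = T")
    case True
    then show ?thesis by (simp add: opt_value_def)
  next
    case False
    have "\<Phi> \<in> feasible_premiums T f r s0 \<U> \<Phi>T \<pi> (Suc t)"
      using feas by (simp add: feasible_premiums_iff)
    then show ?thesis
      using False t opt_value_le[of "Suc t" T \<Phi>] by simp
  qed
  moreover have "payoff f r s0 \<pi> t (h @ [(fst (\<pi> t h), x)]) \<le> r t (state f s0 h) (fst (\<pi> t h)) x" for x
    by (simp add: payoff_def act_def)
  ultimately have "(payoff f r s0 \<pi> t, snd (\<pi> t h), ?\<Psi>)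
      \<in> dominance f r s0 t h (opt_value T f r s0 \<U> \<Phi>T (Suc t)) (fst (\<pi> t h))"
    unfolding dominance_def by blast
  moreover have "(given (payoff f r s0 \<pi> t) h (fst (\<pi> t h)), snd (\<pi> t h), \<Phi> t h)
      \<in> \<U> t h (given ?\<Psi> h (fst (\<pi> t h)))"
    using feas t h unfolding feasible_premiums_iff local_constraint_def given_payoff by simp
  ultimately have "(payoff f r s0 \<pi> t, snd (\<pi> t h), \<Phi> t h)
      \<in> Q_set f r s0 \<U> t h (opt_value T f r s0 \<U> \<Phi>T (Suc t))"
    unfolding Q_set_def by blast
  with opt show ?thesis by blast
qed

text \<open>A feasible pair is built whose premium at \<open>h\<close> is exactly
  \<open>\<phi>\<close>.\<close>

lemma opt_value_le_Q_set:
  fixes \<U> :: "('a, 'x) corr"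
  assumes recursive: "recursive_structure P T \<U> \<Phi>T U"
    and minima: "minima_exist T f r s0 \<U> \<Phi>T" and t: "t \<le> T" and h: "h \<in> hists t"
    and Q: "(X, z, \<phi>) \<in> Q_set f r s0 \<U> t h (opt_value T f r s0 \<U> \<Phi>T (Suc t))"
  shows "opt_value T f r s0 \<U> \<Phi>T t h \<le> ereal \<phi>"
proof -
  obtain \<pi>1 \<Phi>1 where feas1: "\<Phi>1 \<in> feasible_premiums T f r s0 \<U> \<Phi>T \<pi>1 (Suc t)"
    and opt1: "\<And>g. g \<in> hists (Suc t) \<Longrightarrow> opt_value T f r s0 \<U> \<Phi>T (Suc t) g = ereal (\<Phi>1 (Suc t) g)"
    using simultaneous_optimum[OF minima] t by (metis Suc_le_mono)
  obtain \<pi>0 \<Phi>0 where feas0: "\<Phi>0 \<in> feasible_premiums T f r s0 \<U> \<Phi>T \<pi>0 t"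
    by (rule opt_value_attained[OF minima t h])
  let ?\<Psi> = "if t = T then \<Phi>T else \<Phi>1 (Suc t)"
  obtain \<Psi> a where mem: "(given X h a, z, \<phi>) \<in> \<U> t h (given \<Psi> h a)"
    and X: "\<And>x. X (h @ [(a, x)]) \<le> r t (state f s0 h) a x"
    and \<Psi>: "\<And>x. opt_value T f r s0 \<U> \<Phi>T (Suc t) (h @ [(a, x)]) \<le> ereal (\<Psi> (h @ [(a, x)]))"
    using Q by (auto simp: Q_set_def dominance_def)
  \<comment> \<open>On the successors of \<open>h\<close>, \<open>?\<Psi>\<close> is the value
    function at \<open>Suc t\<close>: by \<open>opt1\<close> before the horizon, by definition at
    it.\<close>
  have "?\<Psi> (h @ [(a, x)]) \<le> \<Psi> (h @ [(a, x)])" for x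
    using \<Psi>[of x] opt1[of "h @ [(a, x)]"] h by (auto simp: opt_value_def hists_def)
  then have "AE x in measure_pmf (P h). given ?\<Psi> h a x \<le> given \<Psi> h a x"
    unfolding given_def by simp
  then have "(given X h a, z, \<phi>) \<in> \<U> t h (given ?\<Psi> h a)"
    using recursive t h mem unfolding recursive_structure_def by blast
  moreover have "AE x in measure_pmf (P h). given X h a x \<le> r t (state f s0 h) a x"
    using X by (simp add: given_def)
  ultimately have step: "(r t (state f s0 h) a, z, \<phi>) \<in> \<U> t h (given ?\<Psi> h a)"
    using recursive t h unfolding recursive_structure_def by blast
  \<comment> \<open>Feasibility also constrains the histories that do not pass through \<open>h\<close>; an arbitrary
    feasible pair is used there.\<close>
  define \<pi> where "\<pi> = (\<lambda>k g. if take t g \<noteq> h then \<pi>0 k g else if k = t then (a, z) else \<pi>1 k g)"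
  define \<Phi> where "\<Phi> = (\<lambda>k g. if take t g \<noteq> h then \<Phi>0 k g else if k = t then \<phi> else \<Phi>1 k g)"
  have "\<Phi> \<in> feasible_premiums T f r s0 \<U> \<Phi>T \<pi> t"
    unfolding feasible_premiums_iff
  proof (intro ballI)
    fix k and g :: "('a, 'x) hist"
    assume k: "k \<in> {t..T}" and g: "g \<in> hists k"
    \<comment> \<open>Off \<open>h\<close> the constraint is that of the pair \<open>\<pi>0\<close>,
      \<open>\<Phi>0\<close>; strictly after \<open>h\<close> it is that of \<open>\<pi>1\<close>,
      \<open>\<Phi>1\<close>. Only at \<open>h\<close> itself do the new action and premium meet the
      continuation, and there \<open>step\<close> applies.\<close>
    consider "take t g \<noteq> h" | "take t g = h" "k \<noteq> t" | "g = h" "k = t"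
      using g by (cases "take t g = h"; cases "k = t") (auto simp: hists_def)
    then show "local_constraint T f r s0 \<U> \<Phi>T \<pi> \<Phi> k g"
    proof cases
      case 1
      have "local_constraint T f r s0 \<U> \<Phi>T \<pi> \<Phi> k g \<longleftrightarrow> local_constraint T f r s0 \<U> \<Phi>T \<pi>0 \<Phi>0 k g"
        by (rule local_constraint_cong) (use 1 k g in \<open>auto simp: \<pi>_def \<Phi>_def hists_def\<close>)
      then show ?thesis
        using feas0 k g by (simp add: feasible_premiums_iff)
    next
      case 2
      have "local_constraint T f r s0 \<U> \<Phi>T \<pi> \<Phi> k g \<longleftrightarrow> local_constraint T f r s0 \<U> \<Phi>T \<pi>1 \<Phi>1 k g"
        by (rule local_constraint_cong) (use 2 k g in \<open>auto simp: \<pi>_def \<Phi>_def hists_def\<close>)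
      then show ?thesis
        using feas1 k g 2 by (simp add: feasible_premiums_iff)
    next
      case 3
      have len: "length h = t" using h by (simp add: hists_def)
      then have "given (if t = T then \<Phi>T else \<Phi> (Suc t)) h a = given ?\<Psi> h a"
        by (auto simp: given_def \<Phi>_def)
      moreover have "\<pi> t h = (a, z)" "\<Phi> t h = \<phi>"
        using len by (simp_all add: \<pi>_def \<Phi>_def)
      ultimately show ?thesis
        using step 3 by (simp add: local_constraint_def)
    qed
  qed
  moreover have "\<Phi> t h = \<phi>"
    using h by (simp add: \<Phi>_def hists_def)
  ultimately show ?thesis
    using opt_value_le[OF t] by metis
qed

text \<open>The recursive structure identifies the frontier with the tail frontier from time 0, so
  the whole problem is the tail problem at the empty history.\<close>

lemma gcr_mdp_values_eq:
  assumes "recursive_structure P T \<U> \<Phi>T U"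
  shows "gcr_mdp_values f r s0 U =
    {ereal (\<Phi> 0 []) | \<pi> \<Phi>. \<Phi> \<in> feasible_premiums T f r s0 \<U> \<Phi>T \<pi> 0}"
  using assms by (simp add: gcr_mdp_values_def feasible_premiums_def recursive_structure_def)

theorem theorem25:
  fixes T :: nat
    and f :: "nat \<Rightarrow> 's::finite \<Rightarrow> 'a::finite \<Rightarrow> 'x::finite \<Rightarrow> 's"
    and r :: "nat \<Rightarrow> 's \<Rightarrow> 'a \<Rightarrow> 'x \<Rightarrow> real"
    and Rmax :: real
    and s0 :: 's
    and P :: "('a, 'x) hist \<Rightarrow> 'x pmf"
    and U :: "('a, 'x) act_rule \<Rightarrow> (('a, 'x) stream \<times> ('a, 'x) stream \<times> ('a, 'x) stream) set"
    and \<U> :: "('a, 'x) corr"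
    and \<Phi>T :: "('a, 'x) rv"
  assumes payoff_bound: "\<forall>t\<le>T. \<forall>s a x. \<bar>r t s a x\<bar> \<le> Rmax"
    and frontier: "\<forall>\<alpha>. risk_frontier P T \<alpha> (U \<alpha>)"
    and recursive: "recursive_structure P T \<U> \<Phi>T U"
    and minima: "minima_exist T f r s0 \<U> \<Phi>T"
  shows "(\<forall>t\<le>T. \<forall>h\<in>hists t.
            is_min {ereal \<phi> | X z \<phi>. (X, z, \<phi>) \<in> Q_set f r s0 \<U> t h (opt_value T f r s0 \<U> \<Phi>T (Suc t))}
                   (opt_value T f r s0 \<U> \<Phi>T t h))
         \<and> is_min (gcr_mdp_values f r s0 U) (opt_value T f r s0 \<U> \<Phi>T 0 [])"
proof (intro conjI allI impI ballI)
  fix t and h :: "('a, 'x) hist"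
  assume t: "t \<le> T" and h: "h \<in> hists t"
  show "is_min {ereal \<phi> | X z \<phi>. (X, z, \<phi>) \<in> Q_set f r s0 \<U> t h (opt_value T f r s0 \<U> \<Phi>T (Suc t))}
      (opt_value T f r s0 \<U> \<Phi>T t h)"
    unfolding is_min_def
    using opt_value_in_Q_set[OF minima t h] opt_value_le_Q_set[OF recursive minima t h] by blast
next
  have "[] \<in> hists 0" by (simp add: hists_def)
  \<comment> \<open>The value at time 0 is an iterated infimum and the GCR-MDP a joint one over the
    same feasible pairs; attainment makes the value a member of the joint set.\<close>
  from opt_value_attained[OF minima le0 this]
  have "opt_value T f r s0 \<U> \<Phi>T 0 [] \<in> gcr_mdp_values f r s0 U"
    unfolding gcr_mdp_values_eq[OF recursive] by blast
  moreover have "opt_value T f r s0 \<U> \<Phi>T 0 [] \<le> w" if "w \<in> gcr_mdp_values f r s0 U" for w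
    using that opt_value_le[OF le0] unfolding gcr_mdp_values_eq[OF recursive] by auto
  ultimately show "is_min (gcr_mdp_values f r s0 U) (opt_value T f r s0 \<U> \<Phi>T 0 [])"
    unfolding is_min_def by blast
qed

end
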